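(* Let $r_1,t_2$ be positive integers, let $H_{12}\in\mathbb{C}^{r_1\times t_2}$, and let $G=H_{12}^*H_{12}\in\mathbb{C}^{t_2\times t_2}$ with entries $g_{l,m}$, $1\le l,m\le t_2$. For a matrix $A\in\mathbb{C}^{t_2\times t_2}$ and $x\in\mathbb{C}^{t_2}$ put $S(A,x)=x^*Ax$. For indices $l\neq m$ in $\{1,\dots,t_2\}$ and $\theta,\phi\in\mathbb{R}$, let $r_{l,m}(\theta,\phi)\in\mathbb{C}^{t_2}$ be the column vector all of whose entries are zero except the $l$-th entry, which equals $\cos\theta$, and the $m$-th entry, which equals $e^{-i\phi}\sin\theta$. Define $$c_{l,m}(\theta,\phi)=g_{l,l}\cos^2\theta+g_{m,m}\sin^2\theta-S\big(G,r_{l,m}(\theta,\phi)\big).$$ Then the entries of $G$ are given by $$g_{l,l}=S\big(G,r_{l,m}(0,0)\big),\qquad \operatorname{Re}(g_{l,m})=c_{l,m}(\pi/4,0),\qquad \operatorname{Im}(g_{l,m})=-c_{l,m}(\pi/4,\pi/2).$$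
   Context: Here $^*$ denotes conjugate transpose and $i$ in $e^{-i\phi}$ is the imaginary unit. All vectors are column vectors.
   Formalization: The second identity is proved with the opposite sign, Re(g_{l,m}) = -c_{l,m}(π/4,0); the printed sign fails for H_{12} = [1 1], where g_{1,2} = 1 but c_{1,2}(π/4,0) = -1. *)

theory Defs
  imports "HOL-Analysis.Analysis"
begin

definition conj_transpose :: "complex ^ 'n ^ 'm \<Rightarrow> complex ^ 'm ^ 'n"
  where "conj_transpose A = (\<chi> i j. cnj (A $ j $ i))"

(* The scalar x^* A x; complex-valued, since A is an arbitrary square matrix. *)
definition S :: "complex ^ 'n ^ 'n \<Rightarrow> complex ^ 'n \<Rightarrow> complex"
  where "S A x = (\<Sum>i\<in>UNIV. cnj (x $ i) * (A *v x) $ i)"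

definition rvec :: "'n \<Rightarrow> 'n \<Rightarrow> real \<Rightarrow> real \<Rightarrow> complex ^ 'n"
  where "rvec l m \<theta> \<phi> =
    (\<chi> k. if k = l then complex_of_real (cos \<theta>)
         else if k = m then exp (- \<i> * complex_of_real \<phi>) * complex_of_real (sin \<theta>)
         else 0)"

(* For Hermitian G and l different from m this equals
   - sin (2 theta) * Re (exp (- i phi) * g_{l,m}). Because of the leading minus sign,
   Re g_{l,m} is minus the value at (pi/4, 0); the source prints that identity without
   the minus, which already fails for G the 2 by 2 all-ones matrix. *)
definition cval :: "complex ^ 'n ^ 'n \<Rightarrow> 'n \<Rightarrow> 'n \<Rightarrow> real \<Rightarrow> real \<Rightarrow> complex"
  where "cval G l m \<theta> \<phi> =
    G $ l $ l * complex_of_real ((cos \<theta>)\<^sup>2) + G $ m $ m * complex_of_real ((sin \<theta>)\<^sup>2)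
      - S G (rvec l m \<theta> \<phi>)"

end

theory Submission
  imports Defs
begin

text \<open>A vector supported on \<open>l\<close> and \<open>m\<close> sees only the 2 by 2
  principal submatrix of \<open>G\<close> at these indices (\<open>S_two_entries\<close>). As
  \<open>G\<close> is Hermitian, the two off-diagonal contributions are conjugate, so the quadratic
  form exposes a single real number, twice the real part of the phase-rotated entry, weighted by sin
  \<theta> cos \<theta> (\<open>S_rvec\<close>). \<open>cval\<close> removes the diagonal part and
  keeps minus this cross term (\<open>cval_eq\<close>); choosing the phase then selects the real or
  the imaginary part, each up to that minus sign.\<close>

lemma S_two_entries:
  fixes A :: "complex ^ 'n ^ 'n" and l m :: 'n
  assumes "l \<noteq> m" and supp: "\<And>k. k \<noteq> l \<Longrightarrow> k \<noteq> m \<Longrightarrow> x $ k = 0"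
  shows "S A x = cnj (x $ l) * (A $ l $ l * x $ l + A $ l $ m * x $ m)
    + cnj (x $ m) * (A $ m $ l * x $ l + A $ m $ m * x $ m)"
proof -
  have restrict: "(\<Sum>k\<in>UNIV. f k) = f l + f m"
    if "\<And>k. k \<noteq> l \<Longrightarrow> k \<noteq> m \<Longrightarrow> f k = 0" for f :: "'n \<Rightarrow> complex"
  proof -
    have "(\<Sum>k\<in>UNIV. f k) = (\<Sum>k\<in>{l, m}. f k)"
      by (rule sum.mono_neutral_right) (use that in auto)
    then show ?thesis using \<open>l \<noteq> m\<close> by simp
  qed
  have "(A *v x) $ i = A $ i $ l * x $ l + A $ i $ m * x $ m" for i
    unfolding matrix_vector_mult_def by (simp add: restrict supp)
  then show ?thesis
    unfolding S_def by (simp add: restrict supp)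
qed

text \<open>The phase has modulus one, so it drops out of the \<open>m\<close>-th diagonal term; in
  the cross terms it rotates \<open>A $ l $ m\<close>, and \<open>herm\<close> makes them a
  conjugate pair.\<close>

lemma S_rvec:
  fixes A :: "complex ^ 'n ^ 'n"
  assumes "l \<noteq> m" and herm: "A $ m $ l = cnj (A $ l $ m)"
  shows "S A (rvec l m \<theta> \<phi>) =
    A $ l $ l * complex_of_real ((cos \<theta>)\<^sup>2) + A $ m $ m * complex_of_real ((sin \<theta>)\<^sup>2)
      + complex_of_real (2 * sin \<theta> * cos \<theta> * Re (cis (- \<phi>) * A $ l $ m))"
proof -
  have phase: "exp (- (\<i> * complex_of_real \<phi>)) = cis (- \<phi>)"
    by (simp add: cis_conv_exp)
  have unit: "cnj (cis (- \<phi>)) * cis (- \<phi>) = 1"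
    by (simp add: cis_cnj cis_mult)
  let ?z = "cis (- \<phi>) * A $ l $ m"
  let ?c = "complex_of_real (cos \<theta>)" and ?s = "complex_of_real (sin \<theta>)"
  have "S A (rvec l m \<theta> \<phi>) =
      ?c * (A $ l $ l * ?c + A $ l $ m * (cis (- \<phi>) * ?s))
      + cnj (cis (- \<phi>)) * ?s * (cnj (A $ l $ m) * ?c + A $ m $ m * (cis (- \<phi>) * ?s))"
    using \<open>l \<noteq> m\<close> by (subst S_two_entries[of l m]) (simp_all add: rvec_def phase herm)
  \<comment> \<open>Grouped so that \<open>unit\<close> removes the phase product and
    \<open>complex_add_cnj\<close> turns \<open>?z + cnj ?z\<close> into twice a real part.\<close>
  also have "\<dots> = A $ l $ l * ?c\<^sup>2 + A $ m $ m * ?s\<^sup>2 * (cnj (cis (- \<phi>)) * cis (- \<phi>))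
      + ?s * ?c * (?z + cnj ?z)"
    by (simp add: algebra_simps power2_eq_square)
  finally show ?thesis
    by (simp only: unit complex_add_cnj) (simp add: algebra_simps)
qed

lemma cval_eq:
  assumes "l \<noteq> m" and "A $ m $ l = cnj (A $ l $ m)"
  shows "cval A l m \<theta> \<phi> = - complex_of_real (sin (2 * \<theta>) * Re (cis (- \<phi>) * A $ l $ m))"
  unfolding cval_def S_rvec[OF assms] by (simp add: sin_double)

text \<open>Conjugating each summand swaps its two factors, up to commutativity.\<close>

lemma conj_transpose_mult_self_hermitian:
  "(conj_transpose H ** H) $ j $ i = cnj ((conj_transpose H ** H) $ i $ j)"
  by (simp add: conj_transpose_def matrix_matrix_mult_def mult.commute)

theorem proposition1:
  fixes H12 :: "complex ^ 't2 ^ 'r1"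
    and G :: "complex ^ 't2 ^ 't2"
    and l m :: 't2
  assumes "G = conj_transpose H12 ** H12"
    and "l \<noteq> m"
  shows "G $ l $ l = S G (rvec l m 0 0)
    \<and> complex_of_real (Re (G $ l $ m)) = - cval G l m (pi / 4) 0
    \<and> complex_of_real (Im (G $ l $ m)) = - cval G l m (pi / 4) (pi / 2)"
proof -
  have herm: "G $ m $ l = cnj (G $ l $ m)"
    unfolding assms(1) by (rule conj_transpose_mult_self_hermitian)
  \<comment> \<open>At \<theta> = 0 only the \<open>l\<close>-th diagonal term survives. At \<theta>
    = pi/4 the factor sin (2 \<theta>) is 1, and the phases 1 and -i give Re g and Re (-i g) = Im g
    for g = \<open>G $ l $ m\<close>.\<close>
  show ?thesis
    by (simp add: S_rvec[OF assms(2) herm] cval_eq[OF assms(2) herm])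
qed

end
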